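(* Let $s\in\{1,\dots,N_s\}$, and let $\mathcal{F}_s(\lambda_n,\rho_n^s)$ be the local ELBO and $\mathcal{L}_s(\lambda_n)$ the local LM-ELBO of sensor $s$ defined in the context, with $\rho_n^{s*}(\lambda_n)$ a parameter value such that $q_n(\theta_n^s;\rho_n^{s*}(\lambda_n))=q_n^*(\theta_n^s)$. Then for every $\lambda_n$, $$\mathcal{L}_s(\lambda_n)=\mathcal{F}_s(\lambda_n,\rho_n^{s*}(\lambda_n))\qquad\text{and}\qquad \mathcal{L}_s(\lambda_n)=\max_{\rho_n^s}\mathcal{F}_s(\lambda_n,\rho_n^s).$$
   Context: Model (fixed time step $n$). There are $K$ objects with joint state $X_n=(X_{n,1},\dots,X_{n,K})$, each $X_{n,k}$ a Euclidean vector, and $N_s$ sensors. Sensor $s$ has fixed measurements $Y_n^s=(Y_{n,1}^s,\dots,Y_{n,M_n^s}^s)$ and an unknown association vector $\theta_n^s=(\theta_{n,1}^s,\dots,\theta_{n,M_n^s}^s)\in\{0,1,\dots,K\}^{M_n^s}$. Put $\theta_n=(\theta_n^1,\dots,\theta_n^{N_s})$. The likelihood is $p(Y_n^s|\theta_n^s,X_n)=\prod_{j=1}^{M_n^s}\ell^s(Y_{n,j}^s|X_{n,\theta_{n,j}^s})$, where $\ell^s(y|X_{n,k})=\mathcal{N}(y;HX_{n,k},R_k^s)$ (Gaussian density with mean $HX_{n,k}$ and positive definite covariance $R_k^s$) for $k\ge1$, and $\ell^s(y|X_{n,0})=1/V^s$ with $V^s>0$ for $k=0$ (clutter). The association prior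 is $p(\theta_n^s|M_n^s)=\prod_{j}p(\theta_{n,j}^s)$ with $p(\theta_{n,j}^s=k)=\Lambda_k^s/\sum_{l=0}^K\Lambda_l^s$, where $\Lambda_k^s>0$ are Poisson rates. $\hat p_n(X_n)$ is a fixed predictive prior probability density. Variational families: $q_n(X_n;\lambda_n)=\prod_{k=1}^Kq_n(X_{n,k};\lambda_{n,k})$ with $\lambda_n=[\lambda_{n,1},\dots,\lambda_{n,K}]$ (probability densities), and $q_n(\theta_n;\rho_n)=\prod_{s=1}^{N_s}q_n(\theta_n^s;\rho_n^s)$ with $\rho_n=[\rho_n^1,\dots,\rho_n^{N_s}]$ (probability mass functions), the parameters ranging over subsets of Euclidean spaces. The component parameters $\rho_n^1,\dots,\rho_n^{N_s}$ range independently. Local ELBO: $$\mathcal{F}_s(\lambda_n,\rho_n^s)=\mathrm{E}_{q_n(X_n;\lambda_n)q_n(\theta_n^s;\rho_n^s)}\log p(Y_n^s|\theta_n^s,X_n)+\mathrm{E}_{q_n(\theta_n^s;\rho_n^s)}\log\frac{p(\theta_n^s|M_n^s)}{q_n(\theta_n^s;\rho_n^s)}+\frac1{N_s}\mathrm{E}_{q_n(X_n;\lambda_n)}\log\frac{\hat p_n(X_n)}{q_n(X_n;\lambda_n)}.$$ Optimal association distribution (depending on $\lambda_n$): $q_n^*(\theta_n^s)=\prod_{j=1}^{M_n^s}q_n^*(\theta_{n,j}^s)$, with $q_n^*(\theta_{n,j}^s)\propto p(\theta_{n,j}^s)\exp\big(\mathrm{E}_{q_n(X_n;\lambda_n)}\log\ell^s(Y_{n,j}^s|X_{n,\theta_{n,j}^s})\big)$.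 Local LM-ELBO: $$\mathcal{L}_s(\lambda_n)=\mathrm{E}_{q_n(X_n;\lambda_n)q_n^*(\theta_n^s)}\log p(Y_n^s|\theta_n^s,X_n)+\mathrm{E}_{q_n^*(\theta_n^s)}\log\frac{p(\theta_n^s|M_n^s)}{q_n^*(\theta_n^s)}+\frac1{N_s}\mathrm{E}_{q_n(X_n;\lambda_n)}\log\frac{\hat p_n(X_n)}{q_n(X_n;\lambda_n)}.$$ Standing assumptions: for every $\lambda_n$, $q_n^*(\theta_n^s)$ belongs to the family $\{q_n(\theta_n^s;\rho_n^s)\}$, and $\rho_n^{s*}(\lambda_n)$ denotes a parameter value with $q_n(\theta_n^s;\rho_n^{s*}(\lambda_n))=q_n^*(\theta_n^s)$. All the expectations are finite. The convention $0\log 0=0$ is used. *)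

theory Defs
  imports "HOL-Probability.Probability"
begin

definition positive_definite :: "real ^ 'm ^ 'm \<Rightarrow> bool" where
  "positive_definite R \<longleftrightarrow> transpose R = R \<and> (\<forall>v. v \<noteq> 0 \<longrightarrow> v \<bullet> (R *v v) > 0)"

definition gaussian_density :: "real ^ 'm \<Rightarrow> real ^ 'm ^ 'm \<Rightarrow> real ^ 'm \<Rightarrow> real" where
  "gaussian_density \<mu> R y =
     exp (- (1 / 2) * ((y - \<mu>) \<bullet> (matrix_inv R *v (y - \<mu>)))) / sqrt ((2 * pi) ^ CARD('m) * det R)"

text \<open>The time step is fixed and its index dropped. Objects are numbered \<open>1, \<dots>, K\<close>, sensors
  \<open>1, \<dots>, N\<close> and the measurements of sensor \<open>s\<close> are numbered \<open>1, \<dots>, M s\<close>. All parameters of the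
  components of each variational family live in one ambient Euclidean space.\<close>

record ('d, 'm, 'l, 'r) tracking_model =
  num_objects :: nat
  num_sensors :: nat
  num_meas :: "nat \<Rightarrow> nat"
  meas :: "nat \<Rightarrow> nat \<Rightarrow> real ^ 'm"
  obs_matrix :: "real ^ 'd ^ 'm"
  noise_cov :: "nat \<Rightarrow> nat \<Rightarrow> real ^ 'm ^ 'm"
  volume :: "nat \<Rightarrow> real"
  rate :: "nat \<Rightarrow> nat \<Rightarrow> real"
  pred_prior :: "(nat \<Rightarrow> real ^ 'd) \<Rightarrow> real"
  lam_space :: "(nat \<Rightarrow> 'l) set"
  q_obj :: "nat \<Rightarrow> 'l \<Rightarrow> real ^ 'd \<Rightarrow> real"
  rho_space :: "nat \<Rightarrow> 'r set"
  q_assoc :: "nat \<Rightarrow> 'r \<Rightarrow> (nat \<Rightarrow> nat) \<Rightarrow> real"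

definition state_measure :: "('d::finite, 'm::finite, 'l, 'r) tracking_model \<Rightarrow> (nat \<Rightarrow> real ^ 'd) measure" where
  "state_measure T = (\<Pi>\<^sub>M k\<in>{1..num_objects T}. lborel)"

definition assocs :: "('d::finite, 'm::finite, 'l, 'r) tracking_model \<Rightarrow> nat \<Rightarrow> (nat \<Rightarrow> nat) set" where
  "assocs T s = ({1..num_meas T s} \<rightarrow>\<^sub>E {0..num_objects T})"

text \<open>Index \<open>k = 0\<close> stands for clutter.\<close>

definition meas_lik ::
  "('d::finite, 'm::finite, 'l, 'r) tracking_model \<Rightarrow> nat \<Rightarrow> real ^ 'm \<Rightarrow> nat \<Rightarrow> (nat \<Rightarrow> real ^ 'd) \<Rightarrow> real" where
  "meas_lik T s y k X =
     (if k = 0 then 1 / volume T s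
      else gaussian_density (obs_matrix T *v X k) (noise_cov T s k) y)"

definition likelihood ::
  "('d::finite, 'm::finite, 'l, 'r) tracking_model \<Rightarrow> nat \<Rightarrow> (nat \<Rightarrow> nat) \<Rightarrow> (nat \<Rightarrow> real ^ 'd) \<Rightarrow> real" where
  "likelihood T s \<theta> X = (\<Prod>j\<in>{1..num_meas T s}. meas_lik T s (meas T s j) (\<theta> j) X)"

definition prior1 :: "('d::finite, 'm::finite, 'l, 'r) tracking_model \<Rightarrow> nat \<Rightarrow> nat \<Rightarrow> real" where
  "prior1 T s k = rate T s k / (\<Sum>l\<in>{0..num_objects T}. rate T s l)"

definition assoc_prior :: "('d::finite, 'm::finite, 'l, 'r) tracking_model \<Rightarrow> nat \<Rightarrow> (nat \<Rightarrow> nat) \<Rightarrow> real" where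
  "assoc_prior T s \<theta> = (\<Prod>j\<in>{1..num_meas T s}. prior1 T s (\<theta> j))"

definition q_state ::
  "('d::finite, 'm::finite, 'l, 'r) tracking_model \<Rightarrow> (nat \<Rightarrow> 'l) \<Rightarrow> (nat \<Rightarrow> real ^ 'd) \<Rightarrow> real" where
  "q_state T lam X = (\<Prod>k\<in>{1..num_objects T}. q_obj T k (lam k) (X k))"

definition Q_state ::
  "('d::finite, 'm::finite, 'l, 'r) tracking_model \<Rightarrow> (nat \<Rightarrow> 'l) \<Rightarrow> (nat \<Rightarrow> real ^ 'd) measure" where
  "Q_state T lam = density (state_measure T) (\<lambda>X. ennreal (q_state T lam X))"

definition assoc_measure ::
  "('d::finite, 'm::finite, 'l, 'r) tracking_model \<Rightarrow> nat \<Rightarrow> ((nat \<Rightarrow> nat) \<Rightarrow> real) \<Rightarrow> (nat \<Rightarrow> nat) measure" where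
  "assoc_measure T s q = point_measure (assocs T s) (\<lambda>\<theta>. ennreal (q \<theta>))"

text \<open>Points of zero mass or density do not contribute to an expectation, in accordance with
  the convention \<open>0 log 0 = 0\<close>.\<close>

definition local_elbo ::
  "('d::finite, 'm::finite, 'l, 'r) tracking_model \<Rightarrow> nat \<Rightarrow> (nat \<Rightarrow> 'l) \<Rightarrow> 'r \<Rightarrow> real" where
  "local_elbo T s lam \<rho> =
     (\<integral>(X, \<theta>). ln (likelihood T s \<theta> X) \<partial>(Q_state T lam \<Otimes>\<^sub>M assoc_measure T s (q_assoc T s \<rho>)))
     + (\<integral>\<theta>. ln (assoc_prior T s \<theta> / q_assoc T s \<rho> \<theta>) \<partial>(assoc_measure T s (q_assoc T s \<rho>)))
     + 1 / real (num_sensors T) * (\<integral>X. ln (pred_prior T X / q_state T lam X) \<partial>(Q_state T lam))"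

definition opt_weight ::
  "('d::finite, 'm::finite, 'l, 'r) tracking_model \<Rightarrow> nat \<Rightarrow> (nat \<Rightarrow> 'l) \<Rightarrow> nat \<Rightarrow> nat \<Rightarrow> real" where
  "opt_weight T s lam j k =
     prior1 T s k * exp (\<integral>X. ln (meas_lik T s (meas T s j) k X) \<partial>(Q_state T lam))"

definition opt_assoc1 ::
  "('d::finite, 'm::finite, 'l, 'r) tracking_model \<Rightarrow> nat \<Rightarrow> (nat \<Rightarrow> 'l) \<Rightarrow> nat \<Rightarrow> nat \<Rightarrow> real" where
  "opt_assoc1 T s lam j k = opt_weight T s lam j k / (\<Sum>l\<in>{0..num_objects T}. opt_weight T s lam j l)"

definition opt_assoc ::
  "('d::finite, 'm::finite, 'l, 'r) tracking_model \<Rightarrow> nat \<Rightarrow> (nat \<Rightarrow> 'l) \<Rightarrow> (nat \<Rightarrow> nat) \<Rightarrow> real" where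
  "opt_assoc T s lam \<theta> = (\<Prod>j\<in>{1..num_meas T s}. opt_assoc1 T s lam j (\<theta> j))"

definition local_lm_elbo ::
  "('d::finite, 'm::finite, 'l, 'r) tracking_model \<Rightarrow> nat \<Rightarrow> (nat \<Rightarrow> 'l) \<Rightarrow> real" where
  "local_lm_elbo T s lam =
     (\<integral>(X, \<theta>). ln (likelihood T s \<theta> X) \<partial>(Q_state T lam \<Otimes>\<^sub>M assoc_measure T s (opt_assoc T s lam)))
     + (\<integral>\<theta>. ln (assoc_prior T s \<theta> / opt_assoc T s lam \<theta>) \<partial>(assoc_measure T s (opt_assoc T s lam)))
     + 1 / real (num_sensors T) * (\<integral>X. ln (pred_prior T X / q_state T lam X) \<partial>(Q_state T lam))"

text \<open>Finiteness of an expectation is integrability. Since \<open>ln 0 = 0\<close> in the library,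
  finiteness of \<open>E log (pred_prior / q_state)\<close> additionally has to exclude, by
  \<open>pred_prior_pos\<close>, that the integrand is minus infinity on a set of positive probability. The
  expectations over \<open>\<theta>\<close> alone are finite sums.\<close>

locale tracking =
  fixes T :: "('d::finite, 'm::finite, 'l::euclidean_space, 'r::euclidean_space) tracking_model"
  assumes noise_cov_pos: "\<And>s k. s \<in> {1..num_sensors T} \<Longrightarrow> k \<in> {1..num_objects T} \<Longrightarrow>
      positive_definite (noise_cov T s k)"
    and volume_pos: "\<And>s. s \<in> {1..num_sensors T} \<Longrightarrow> volume T s > 0"
    and rate_pos: "\<And>s k. s \<in> {1..num_sensors T} \<Longrightarrow> k \<in> {0..num_objects T} \<Longrightarrow> rate T s k > 0"
    and pred_prior_measurable: "pred_prior T \<in> borel_measurable (state_measure T)"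
    and pred_prior_nonneg: "\<And>X. X \<in> space (state_measure T) \<Longrightarrow> pred_prior T X \<ge> 0"
    and pred_prior_prob: "prob_space (density (state_measure T) (\<lambda>X. ennreal (pred_prior T X)))"
    and lam_space: "lam_space T \<subseteq> ({1..num_objects T} \<rightarrow>\<^sub>E UNIV)"
    and q_obj_measurable: "\<And>lam k. lam \<in> lam_space T \<Longrightarrow> k \<in> {1..num_objects T} \<Longrightarrow>
      q_obj T k (lam k) \<in> borel_measurable lborel"
    and q_obj_nonneg: "\<And>lam k x. lam \<in> lam_space T \<Longrightarrow> k \<in> {1..num_objects T} \<Longrightarrow>
      q_obj T k (lam k) x \<ge> 0"
    and q_obj_prob: "\<And>lam k. lam \<in> lam_space T \<Longrightarrow> k \<in> {1..num_objects T} \<Longrightarrow>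
      prob_space (density lborel (\<lambda>x. ennreal (q_obj T k (lam k) x)))"
    and q_assoc_nonneg: "\<And>s \<rho> \<theta>. s \<in> {1..num_sensors T} \<Longrightarrow> \<rho> \<in> rho_space T s \<Longrightarrow>
      \<theta> \<in> assocs T s \<Longrightarrow> q_assoc T s \<rho> \<theta> \<ge> 0"
    and q_assoc_sum: "\<And>s \<rho>. s \<in> {1..num_sensors T} \<Longrightarrow> \<rho> \<in> rho_space T s \<Longrightarrow>
      (\<Sum>\<theta>\<in>assocs T s. q_assoc T s \<rho> \<theta>) = 1"
    and opt_assoc_in_family: "\<And>s lam. s \<in> {1..num_sensors T} \<Longrightarrow> lam \<in> lam_space T \<Longrightarrow>
      \<exists>\<rho>\<in>rho_space T s. \<forall>\<theta>\<in>assocs T s. q_assoc T s \<rho> \<theta> = opt_assoc T s lam \<theta>"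
    and meas_lik_integrable: "\<And>s lam j k. s \<in> {1..num_sensors T} \<Longrightarrow> lam \<in> lam_space T \<Longrightarrow>
      j \<in> {1..num_meas T s} \<Longrightarrow> k \<in> {0..num_objects T} \<Longrightarrow>
      integrable (Q_state T lam) (\<lambda>X. ln (meas_lik T s (meas T s j) k X))"
    and likelihood_integrable: "\<And>s lam \<rho>. s \<in> {1..num_sensors T} \<Longrightarrow> lam \<in> lam_space T \<Longrightarrow>
      \<rho> \<in> rho_space T s \<Longrightarrow>
      integrable (Q_state T lam \<Otimes>\<^sub>M assoc_measure T s (q_assoc T s \<rho>))
        (\<lambda>(X, \<theta>). ln (likelihood T s \<theta> X))"
    and pred_prior_integrable: "\<And>lam. lam \<in> lam_space T \<Longrightarrow>
      integrable (Q_state T lam) (\<lambda>X. ln (pred_prior T X / q_state T lam X))"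
    and pred_prior_pos: "\<And>lam. lam \<in> lam_space T \<Longrightarrow> AE X in Q_state T lam. pred_prior T X > 0"

end

(* By Fubini, the expected log-likelihood of an association theta under q(X) is the sum over j of
   E log l(Y_j | X_theta_j). Exponentiating and multiplying by the prior gives q* up to the
   normalizing constants, so F_s is a constant in rho minus the Kullback-Leibler divergence of
   q(theta; rho) from q*. Gibbs' inequality then identifies q* as the maximizer. *)

theory Submission
  imports Defs
begin

text \<open>Nonnegativity of the Kullback-Leibler divergence, from ln x \<le> x - 1 at x =
  \<open>p a / q a\<close>. Where \<open>q a = 0\<close> the summand vanishes, and the termwise
  bound \<open>p a - q a\<close> is positive.\<close>

lemma gibbs_inequality:
  fixes p q :: "'a \<Rightarrow> real"
  assumes "finite A"
    and p_pos: "\<And>a. a \<in> A \<Longrightarrow> p a > 0"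
    and q_nonneg: "\<And>a. a \<in> A \<Longrightarrow> q a \<ge> 0"
    and sum_le: "sum p A \<le> sum q A"
  shows "(\<Sum>a\<in>A. q a * ln (p a / q a)) \<le> 0"
proof -
  have "q a * ln (p a / q a) \<le> p a - q a" if "a \<in> A" for a
  proof (cases "q a = 0")
    case True
    then show ?thesis using p_pos[OF that] by simp
  next
    case False
    then have "q a > 0" using q_nonneg[OF that] by simp
    then have "q a * ln (p a / q a) \<le> q a * (p a / q a - 1)"
      using p_pos[OF that] by (intro mult_left_mono ln_le_minus_one) auto
    also have "\<dots> = p a - q a" using \<open>q a > 0\<close> by (simp add: right_diff_distrib)
    finally show ?thesis .
  qed
  then have "(\<Sum>a\<in>A. q a * ln (p a / q a)) \<le> (\<Sum>a\<in>A. p a - q a)"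
    by (rule sum_mono)
  with sum_le show ?thesis by (simp add: sum_subtractf)
qed

text \<open>One of the two sigma-finiteness facts behind Fubini. The counting measure on a finite
  set is sigma-finite, and a density with finite values preserves this.\<close>

lemma sigma_finite_point_measure_finite:
  assumes "finite A"
  shows "sigma_finite_measure (point_measure A (\<lambda>a. ennreal (f a)))"
proof -
  interpret sigma_finite_measure "count_space A"
    using assms by (rule sigma_finite_measure_count_space_finite)
  show ?thesis
    unfolding point_measure_def by (subst sigma_finite_iff_density_finite) auto
qed

lemma point_measure_cong:
  assumes "\<And>a. a \<in> A \<Longrightarrow> f a = g a"
  shows "point_measure A f = point_measure A g"
  unfolding point_measure_def
  using assms by (intro density_cong) (auto simp: AE_count_space)

text \<open>The kernel is trivial: \<open>R *v v = 0\<close> forces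
  \<open>v \<bullet> (R *v v) = 0\<close>, hence \<open>v = 0\<close>.\<close>

lemma positive_definite_det_nonzero:
  assumes "positive_definite R"
  shows "det R \<noteq> 0"
proof -
  have "R *v v = 0 \<Longrightarrow> v = 0" for v
    using assms by (metis positive_definite_def inner_zero_right less_irrefl)
  then have "invertible R"
    unfolding invertible_left_inverse matrix_left_invertible_ker by blast
  then show ?thesis by (simp add: invertible_det_nz)
qed

text \<open>The numerator is an exponential and \<open>sqrt\<close> vanishes only at 0. Nonvanishing
  is the form in which \<open>ln_prod\<close> takes its condition on the factors.\<close>

lemma gaussian_density_nonzero:
  assumes "positive_definite R"
  shows "gaussian_density \<mu> R y \<noteq> 0"
  using positive_definite_det_nonzero[OF assms] by (simp add: gaussian_density_def)

lemma finite_assocs: "finite (assocs T s)"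
  unfolding assocs_def by (intro finite_PiE) auto

lemma assocs_le: "\<theta> \<in> assocs T s \<Longrightarrow> j \<in> {1..num_meas T s} \<Longrightarrow> \<theta> j \<in> {0..num_objects T}"
  unfolding assocs_def by (rule PiE_mem)

text \<open>Both sides are the same functional of a mass function. The two mass functions are known
  to agree only on \<open>assocs T s\<close>, so the measure is rewritten first and then the
  integrand on its space.\<close>

lemma local_lm_elbo_eq_local_elbo:
  assumes eq: "\<And>\<theta>. \<theta> \<in> assocs T s \<Longrightarrow> q_assoc T s \<rho> \<theta> = opt_assoc T s lam \<theta>"
  shows "local_lm_elbo T s lam = local_elbo T s lam \<rho>"
proof -
  have measure_eq: "assoc_measure T s (q_assoc T s \<rho>) = assoc_measure T s (opt_assoc T s lam)"
    unfolding assoc_measure_def by (rule point_measure_cong) (simp add: eq)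
  have "(\<integral>\<theta>. ln (assoc_prior T s \<theta> / q_assoc T s \<rho> \<theta>) \<partial>assoc_measure T s (opt_assoc T s lam))
      = (\<integral>\<theta>. ln (assoc_prior T s \<theta> / opt_assoc T s lam \<theta>) \<partial>assoc_measure T s (opt_assoc T s lam))"
    by (rule Bochner_Integration.integral_cong)
      (simp_all add: assoc_measure_def space_point_measure eq)
  then show ?thesis
    unfolding local_lm_elbo_def local_elbo_def measure_eq by simp
qed

context tracking
begin

lemma meas_lik_nonzero:
  assumes "s \<in> {1..num_sensors T}" "k \<in> {0..num_objects T}"
  shows "meas_lik T s y k X \<noteq> 0"
  using assms volume_pos[of s] gaussian_density_nonzero[OF noise_cov_pos[of s k]]
  by (auto simp: meas_lik_def)

lemma prior1_pos:
  assumes "s \<in> {1..num_sensors T}" "k \<in> {0..num_objects T}"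
  shows "prior1 T s k > 0"
  unfolding prior1_def using assms by (intro divide_pos_pos sum_pos rate_pos) auto

lemma opt_weight_pos:
  assumes "s \<in> {1..num_sensors T}" "k \<in> {0..num_objects T}"
  shows "opt_weight T s lam j k > 0"
  unfolding opt_weight_def using prior1_pos[OF assms] by simp

lemma sum_opt_weight_pos:
  assumes "s \<in> {1..num_sensors T}"
  shows "(\<Sum>l\<in>{0..num_objects T}. opt_weight T s lam j l) > 0"
  using assms by (intro sum_pos opt_weight_pos) auto

lemma opt_assoc1_pos:
  assumes "s \<in> {1..num_sensors T}" "k \<in> {0..num_objects T}"
  shows "opt_assoc1 T s lam j k > 0"
  unfolding opt_assoc1_def
  using opt_weight_pos[OF assms] sum_opt_weight_pos[OF assms(1)] by (rule divide_pos_pos)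

lemma opt_assoc_pos:
  assumes "s \<in> {1..num_sensors T}" "\<theta> \<in> assocs T s"
  shows "opt_assoc T s lam \<theta> > 0"
  unfolding opt_assoc_def using assms by (intro prod_pos ballI opt_assoc1_pos assocs_le)

lemma assoc_prior_pos:
  assumes "s \<in> {1..num_sensors T}" "\<theta> \<in> assocs T s"
  shows "assoc_prior T s \<theta> > 0"
  unfolding assoc_prior_def using assms by (intro prod_pos ballI prior1_pos assocs_le)

text \<open>Normalization is inherited from the variational family: some member coincides with
  \<open>opt_assoc\<close> on \<open>assocs T s\<close>, and every member has total mass 1.\<close>

lemma sum_opt_assoc:
  assumes "s \<in> {1..num_sensors T}" "lam \<in> lam_space T"
  shows "(\<Sum>\<theta>\<in>assocs T s. opt_assoc T s lam \<theta>) = 1"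
  using opt_assoc_in_family[OF assms] q_assoc_sum[OF assms(1)] by (metis (no_types, lifting) sum.cong)

text \<open>The other ingredient of Fubini: a finite product of Lebesgue measures is sigma-finite,
  and \<open>q_state\<close> is a measurable density with finite values.\<close>

lemma sigma_finite_Q_state:
  assumes "lam \<in> lam_space T"
  shows "sigma_finite_measure (Q_state T lam)"
proof -
  interpret product_sigma_finite "\<lambda>_::nat. lborel :: (real ^ 'd) measure"
    by standard
  interpret sigma_finite_measure "state_measure T"
    unfolding state_measure_def by (rule sigma_finite) simp
  have "q_state T lam \<in> borel_measurable (state_measure T)"
    unfolding q_state_def[abs_def] state_measure_def
  proof (rule borel_measurable_prod)
    fix k assume k: "k \<in> {1..num_objects T}"
    show "(\<lambda>X. q_obj T k (lam k) (X k)) \<in> borel_measurable (\<Pi>\<^sub>M k\<in>{1..num_objects T}. lborel)"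
      by (rule measurable_compose[OF measurable_component_singleton[OF k]
            q_obj_measurable[OF assms k]])
  qed
  then show ?thesis
    unfolding Q_state_def by (subst sigma_finite_iff_density_finite) auto
qed

lemma integral_ln_likelihood:
  assumes s: "s \<in> {1..num_sensors T}" and lam: "lam \<in> lam_space T" and \<theta>: "\<theta> \<in> assocs T s"
  shows "(\<integral>X. ln (likelihood T s \<theta> X) \<partial>Q_state T lam)
    = (\<Sum>j\<in>{1..num_meas T s}. \<integral>X. ln (meas_lik T s (meas T s j) (\<theta> j) X) \<partial>Q_state T lam)"
proof -
  have "ln (likelihood T s \<theta> X)
      = (\<Sum>j\<in>{1..num_meas T s}. ln (meas_lik T s (meas T s j) (\<theta> j) X))" for X
    unfolding likelihood_def by (intro ln_prod meas_lik_nonzero s assocs_le[OF \<theta>]) auto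
  then show ?thesis
    by (simp add: Bochner_Integration.integral_sum meas_lik_integrable[OF s lam _ assocs_le[OF \<theta>]])
qed

text \<open>The logarithm undoes the exponential in \<open>opt_weight\<close>, so the log joint
  weight of \<theta> is \<open>ln (opt_assoc T s lam \<theta>)\<close> up to the log normalizers,
  whose sum is the same for every \<theta>.\<close>

lemma ln_opt_assoc:
  assumes s: "s \<in> {1..num_sensors T}" and lam: "lam \<in> lam_space T" and \<theta>: "\<theta> \<in> assocs T s"
  shows "(\<integral>X. ln (likelihood T s \<theta> X) \<partial>Q_state T lam) + ln (assoc_prior T s \<theta>)
    = ln (opt_assoc T s lam \<theta>)
      + (\<Sum>j\<in>{1..num_meas T s}. ln (\<Sum>l\<in>{0..num_objects T}. opt_weight T s lam j l))"
proof -
  have "ln (opt_assoc1 T s lam j (\<theta> j))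
      = ln (prior1 T s (\<theta> j)) + (\<integral>X. ln (meas_lik T s (meas T s j) (\<theta> j) X) \<partial>Q_state T lam)
        - ln (\<Sum>l\<in>{0..num_objects T}. opt_weight T s lam j l)"
    if "j \<in> {1..num_meas T s}" for j
  proof -
    note \<theta>j = assocs_le[OF \<theta> that]
    have "ln (opt_assoc1 T s lam j (\<theta> j)) = ln (opt_weight T s lam j (\<theta> j))
        - ln (\<Sum>l\<in>{0..num_objects T}. opt_weight T s lam j l)"
      unfolding opt_assoc1_def by (intro ln_divide_pos opt_weight_pos[OF s \<theta>j] sum_opt_weight_pos[OF s])
    \<comment> \<open>The definition is instantiated at \<open>\<theta> j\<close> so that the
      weights inside the normalizing sum stay folded.\<close>
    then show ?thesis
      using prior1_pos[OF s \<theta>j] by (simp add: opt_weight_def[of T s lam j "\<theta> j"] ln_mult_pos)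
  qed
  moreover have "ln (opt_assoc T s lam \<theta>) = (\<Sum>j\<in>{1..num_meas T s}. ln (opt_assoc1 T s lam j (\<theta> j)))"
    unfolding opt_assoc_def using opt_assoc1_pos[OF s assocs_le[OF \<theta>]]
    by (intro ln_prod) (auto simp: less_imp_neq[symmetric])
  moreover have "ln (assoc_prior T s \<theta>) = (\<Sum>j\<in>{1..num_meas T s}. ln (prior1 T s (\<theta> j)))"
    unfolding assoc_prior_def using prior1_pos[OF s assocs_le[OF \<theta>]]
    by (intro ln_prod) (auto simp: less_imp_neq[symmetric])
  ultimately show ?thesis
    by (simp add: integral_ln_likelihood[OF s lam \<theta>] sum.distrib sum_subtractf)
qed

text \<open>The first sum is minus the divergence of \<open>q_assoc T s \<rho>\<close> from
  \<open>opt_assoc T s lam\<close>; it is the only term that depends on \<rho>.\<close>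

lemma local_elbo_eq:
  assumes s: "s \<in> {1..num_sensors T}" and lam: "lam \<in> lam_space T" and \<rho>: "\<rho> \<in> rho_space T s"
  shows "local_elbo T s lam \<rho> =
    (\<Sum>\<theta>\<in>assocs T s. q_assoc T s \<rho> \<theta> * ln (opt_assoc T s lam \<theta> / q_assoc T s \<rho> \<theta>))
    + (\<Sum>j\<in>{1..num_meas T s}. ln (\<Sum>l\<in>{0..num_objects T}. opt_weight T s lam j l))
    + 1 / real (num_sensors T) * (\<integral>X. ln (pred_prior T X / q_state T lam X) \<partial>(Q_state T lam))"
    (is "_ = _ + ?C + ?D")
proof -
  let ?q = "q_assoc T s \<rho>"
  let ?N = "assoc_measure T s ?q"
  let ?E = "\<lambda>\<theta>. \<integral>X. ln (likelihood T s \<theta> X) \<partial>Q_state T lam"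
  have integral_N: "(\<integral>\<theta>. g \<theta> \<partial>?N) = (\<Sum>\<theta>\<in>assocs T s. ?q \<theta> * g \<theta>)" for g :: "_ \<Rightarrow> real"
    unfolding assoc_measure_def point_measure_def
    using q_assoc_nonneg[OF s \<rho>]
    by (simp add: integral_density AE_count_space lebesgue_integral_count_space_finite finite_assocs)
  interpret Q: sigma_finite_measure "Q_state T lam"
    using lam by (rule sigma_finite_Q_state)
  interpret N: sigma_finite_measure ?N
    unfolding assoc_measure_def by (rule sigma_finite_point_measure_finite[OF finite_assocs])
  interpret pair_sigma_finite "Q_state T lam" ?N ..
  \<comment> \<open>Fubini with the state integrated out first, so that the outer expectation
    becomes a finite sum over associations.\<close>
  have "(\<integral>(X, \<theta>). ln (likelihood T s \<theta> X) \<partial>(Q_state T lam \<Otimes>\<^sub>M ?N)) = (\<integral>\<theta>. ?E \<theta> \<partial>?N)"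
    using likelihood_integrable[OF s lam \<rho>] by (rule integral_snd[symmetric])
  then have "local_elbo T s lam \<rho> =
      (\<Sum>\<theta>\<in>assocs T s. ?q \<theta> * (?E \<theta> + ln (assoc_prior T s \<theta> / ?q \<theta>))) + ?D"
    unfolding local_elbo_def by (simp add: integral_N sum.distrib distrib_left)
  also have "(\<Sum>\<theta>\<in>assocs T s. ?q \<theta> * (?E \<theta> + ln (assoc_prior T s \<theta> / ?q \<theta>)))
      = (\<Sum>\<theta>\<in>assocs T s. ?q \<theta> * ln (opt_assoc T s lam \<theta> / ?q \<theta>) + ?q \<theta> * ?C)"
  proof (rule sum.cong)
    fix \<theta> assume \<theta>: "\<theta> \<in> assocs T s"
    show "?q \<theta> * (?E \<theta> + ln (assoc_prior T s \<theta> / ?q \<theta>))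
        = ?q \<theta> * ln (opt_assoc T s lam \<theta> / ?q \<theta>) + ?q \<theta> * ?C"
    \<comment> \<open>Points of zero mass make both sides 0. Elsewhere the quotients have nonzero
      numerator and denominator, and their logarithms split.\<close>
    proof (cases "?q \<theta> = 0")
      case False
      then have "?E \<theta> + ln (assoc_prior T s \<theta> / ?q \<theta>) = ln (opt_assoc T s lam \<theta> / ?q \<theta>) + ?C"
        using ln_opt_assoc[OF s lam \<theta>] opt_assoc_pos[OF s \<theta>, of lam] assoc_prior_pos[OF s \<theta>]
        by (simp add: ln_div)
      then show ?thesis by (simp add: distrib_left)
    qed simp
  qed simp
  \<comment> \<open>The constant comes out with factor 1, the total mass of
    \<open>?q\<close>.\<close>
  also have "\<dots> = (\<Sum>\<theta>\<in>assocs T s. ?q \<theta> * ln (opt_assoc T s lam \<theta> / ?q \<theta>)) + ?C"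
    by (simp add: sum.distrib sum_distrib_right[symmetric] q_assoc_sum[OF s \<rho>])
  finally show ?thesis .
qed

lemma local_elbo_le_opt:
  assumes s: "s \<in> {1..num_sensors T}" and lam: "lam \<in> lam_space T"
    and \<rho>: "\<rho> \<in> rho_space T s" and \<rho>': "\<rho>' \<in> rho_space T s"
    and opt: "\<And>\<theta>. \<theta> \<in> assocs T s \<Longrightarrow> q_assoc T s \<rho>' \<theta> = opt_assoc T s lam \<theta>"
  shows "local_elbo T s lam \<rho> \<le> local_elbo T s lam \<rho>'"
proof -
  have "(\<Sum>\<theta>\<in>assocs T s. q_assoc T s \<rho> \<theta> * ln (opt_assoc T s lam \<theta> / q_assoc T s \<rho> \<theta>)) \<le> 0"
    using finite_assocs opt_assoc_pos[OF s] q_assoc_nonneg[OF s \<rho>]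
    by (rule gibbs_inequality) (simp_all add: sum_opt_assoc[OF s lam] q_assoc_sum[OF s \<rho>])
  \<comment> \<open>At \<open>\<rho>'\<close> every quotient is 1, so the divergence is zero and the
    bound is attained.\<close>
  moreover have
    "(\<Sum>\<theta>\<in>assocs T s. q_assoc T s \<rho>' \<theta> * ln (opt_assoc T s lam \<theta> / q_assoc T s \<rho>' \<theta>)) = 0"
    using opt_assoc_pos[OF s] by (intro sum.neutral) (auto simp: opt)
  ultimately show ?thesis
    by (simp add: local_elbo_eq[OF s lam \<rho>] local_elbo_eq[OF s lam \<rho>'])
qed

end

theorem mainTheorem4:
  fixes T :: "('d::finite, 'm::finite, 'l::euclidean_space, 'r::euclidean_space) tracking_model"
    and s :: nat
    and \<rho>_star :: "(nat \<Rightarrow> 'l) \<Rightarrow> 'r"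
  assumes "tracking T"
    and "s \<in> {1..num_sensors T}"
    and "\<And>lam. lam \<in> lam_space T \<Longrightarrow> \<rho>_star lam \<in> rho_space T s"
    and "\<And>lam \<theta>. lam \<in> lam_space T \<Longrightarrow> \<theta> \<in> assocs T s \<Longrightarrow>
           q_assoc T s (\<rho>_star lam) \<theta> = opt_assoc T s lam \<theta>"
  shows "\<forall>lam\<in>lam_space T.
           local_lm_elbo T s lam = local_elbo T s lam (\<rho>_star lam) \<and>
           (\<exists>\<rho>\<in>rho_space T s. local_lm_elbo T s lam = local_elbo T s lam \<rho>) \<and>
           (\<forall>\<rho>\<in>rho_space T s. local_elbo T s lam \<rho> \<le> local_lm_elbo T s lam)"
proof
  fix lam assume lam: "lam \<in> lam_space T"
  have eq: "local_lm_elbo T s lam = local_elbo T s lam (\<rho>_star lam)"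
    by (rule local_lm_elbo_eq_local_elbo) (rule assms(4)[OF lam])
  moreover have "local_elbo T s lam \<rho> \<le> local_elbo T s lam (\<rho>_star lam)"
    if "\<rho> \<in> rho_space T s" for \<rho>
    using assms(1,2) lam that assms(3)[OF lam] assms(4)[OF lam]
    by (rule tracking.local_elbo_le_opt)
  \<comment> \<open>The maximum is expressed as an attained upper bound, with
    \<open>\<rho>_star lam\<close> as the witness of attainment.\<close>
  ultimately show "local_lm_elbo T s lam = local_elbo T s lam (\<rho>_star lam) \<and>
           (\<exists>\<rho>\<in>rho_space T s. local_lm_elbo T s lam = local_elbo T s lam \<rho>) \<and>
           (\<forall>\<rho>\<in>rho_space T s. local_elbo T s lam \<rho> \<le> local_lm_elbo T s lam)"
    using assms(3)[OF lam] by auto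
qed

end
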